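(* Let $t\in[0,1)$. The operator $\mathcal{C}_t\in\mathcal{L}(ces_\infty)$ satisfies $\|\mathcal{C}_t\|_{ces_\infty\to ces_\infty}=1$, is compact and has spectrum $\sigma(\mathcal{C}_t;ces_\infty)=\Lambda\cup\{0\}$. Moreover, the fine spectra of $\mathcal{C}_t$ are given by $$\sigma_{\mathrm p}(\mathcal{C}_t;ces_\infty)=\Lambda,\quad \sigma_{\mathrm c}(\mathcal{C}_t;ces_\infty)=\emptyset,\quad \sigma_{\mathrm r}(\mathcal{C}_t;ces_\infty)=\{0\}.$$
   Context: Let $\mathbb{N}_0=\{0,1,2,\dots\}$ and $\Lambda:=\{1/(n+1):n\in\mathbb{N}_0\}$. For $t\in[0,1]$ the generalized Cesàro operator on $\mathbb{C}^{\mathbb{N}_0}$ is $(\mathcal{C}_tx)_n=\frac{1}{n+1}\sum_{k=0}^n t^{n-k}x_k$ (with $0^0=1$); in particular $(\mathcal{C}_1x)_n=\frac1{n+1}\sum_{k=0}^nx_k$. $\mathcal{C}_t\in\mathcal{L}(X)$ means that it maps $X$ continuously into itself; the restriction is also denoted $\mathcal{C}_t$. For $x\in\mathbb{C}^{\mathbb{N}_0}$ put $|x|=(|x_n|)_n$. $ces_\infty:=\{x\in\mathbb{C}^{\mathbb{N}_0}:\mathcal{C}_1|x|\in\ell^\infty\}$ with norm $\|x\|_{ces_\infty}:=\|\mathcal{C}_1|x|\|_\infty$; it is a Banach space. $\mathcal{L}(X)$ is the space of continuous linear operators on $X$. For $T\in\mathcal{L}(X)$: $\sigma(T;X)$ is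 the set of $\lambda\in\mathbb{C}$ with $T-\lambda I$ not invertible in $\mathcal{L}(X)$; $\sigma_{\mathrm p}(T;X)$ is the set of $\lambda$ with $T-\lambda I$ not injective; $\sigma_{\mathrm c}(T;X)$ is the set of $\lambda$ with $T-\lambda I$ injective and range a proper dense subspace of $X$; $\sigma_{\mathrm r}(T;X)$ is the set of $\lambda$ with $T-\lambda I$ injective and range not dense in $X$. *)

theory Defs
  imports "HOL-Analysis.Analysis"
begin

section \<open>Complex normed spaces, continuous linear operators and their spectra\<close>

text \<open>
  HOL-Analysis only has real normed spaces. Here \<open>scaleR\<close> is the restriction
  of the complex scalar multiplication \<open>scaleC\<close>.
\<close>

class complex_normed_vector = real_normed_vector +
  fixes scaleC :: "complex \<Rightarrow> 'a \<Rightarrow> 'a"  (infixr \<open>*\<^sub>C\<close> 75)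
  assumes scaleC_add_right: "c *\<^sub>C (x + y) = c *\<^sub>C x + c *\<^sub>C y"
    and scaleC_add_left: "(c + d) *\<^sub>C x = c *\<^sub>C x + d *\<^sub>C x"
    and scaleC_scaleC: "c *\<^sub>C d *\<^sub>C x = (c * d) *\<^sub>C x"
    and scaleC_one: "1 *\<^sub>C x = x"
    and scaleR_scaleC: "r *\<^sub>R x = complex_of_real r *\<^sub>C x"
    and norm_scaleC: "norm (c *\<^sub>C x) = cmod c * norm x"

lemma vector_space_scaleC:
  "vector_space (scaleC :: complex \<Rightarrow> 'a \<Rightarrow> 'a::complex_normed_vector)"
  by unfold_locales
    (simp_all add: scaleC_add_right scaleC_add_left scaleC_scaleC scaleC_one)

definition cont_lin_ops :: "('a::complex_normed_vector \<Rightarrow> 'a) set" where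
  "cont_lin_ops = {T. Vector_Spaces.linear scaleC scaleC T \<and> continuous_on UNIV T}"

definition compact_op :: "('a::complex_normed_vector \<Rightarrow> 'a) \<Rightarrow> bool" where
  "compact_op T \<longleftrightarrow>
    T \<in> cont_lin_ops \<and> (\<forall>B. bounded B \<longrightarrow> compact (closure (T ` B)))"

definition shifted :: "('a::complex_normed_vector \<Rightarrow> 'a) \<Rightarrow> complex \<Rightarrow> 'a \<Rightarrow> 'a" where
  "shifted T \<mu> = (\<lambda>x. T x - \<mu> *\<^sub>C x)"

definition invertible_op :: "('a::complex_normed_vector \<Rightarrow> 'a) \<Rightarrow> bool" where
  "invertible_op T \<longleftrightarrow> (\<exists>S \<in> cont_lin_ops. S \<circ> T = id \<and> T \<circ> S = id)"

definition spectrum :: "('a::complex_normed_vector \<Rightarrow> 'a) \<Rightarrow> complex set" where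
  "spectrum T = {\<mu>. \<not> invertible_op (shifted T \<mu>)}"

definition point_spectrum :: "('a::complex_normed_vector \<Rightarrow> 'a) \<Rightarrow> complex set" where
  "point_spectrum T = {\<mu>. \<not> inj (shifted T \<mu>)}"

definition continuous_spectrum :: "('a::complex_normed_vector \<Rightarrow> 'a) \<Rightarrow> complex set" where
  "continuous_spectrum T =
    {\<mu>. inj (shifted T \<mu>) \<and> range (shifted T \<mu>) \<noteq> UNIV
       \<and> closure (range (shifted T \<mu>)) = UNIV}"

definition residual_spectrum :: "('a::complex_normed_vector \<Rightarrow> 'a) \<Rightarrow> complex set" where
  "residual_spectrum T =
    {\<mu>. inj (shifted T \<mu>) \<and> closure (range (shifted T \<mu>)) \<noteq> UNIV}"


section \<open>Generalized Cesaro operators and the space \<open>ces\<^sub>\<infinity>\<close>\<close>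

definition cesaro :: "real \<Rightarrow> (nat \<Rightarrow> complex) \<Rightarrow> nat \<Rightarrow> complex" where
  "cesaro t x n = 1 / (of_nat n + 1) * (\<Sum>k\<le>n. complex_of_real t ^ (n - k) * x k)"

definition seq_abs :: "(nat \<Rightarrow> complex) \<Rightarrow> nat \<Rightarrow> complex" where
  "seq_abs x n = complex_of_real (cmod (x n))"

definition linfty :: "(nat \<Rightarrow> complex) set" where
  "linfty = {x. bounded (range x)}"

definition linfty_norm :: "(nat \<Rightarrow> complex) \<Rightarrow> real" where
  "linfty_norm x = (SUP n. cmod (x n))"

definition ces_infty :: "(nat \<Rightarrow> complex) set" where
  "ces_infty = {x. cesaro 1 (seq_abs x) \<in> linfty}"

lemma cmod_cesaro_one_seq_abs:
  "cmod (cesaro 1 (seq_abs x) n) = (\<Sum>k\<le>n. cmod (x k)) / (real n + 1)"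
proof -
  have "cesaro 1 (seq_abs x) n = complex_of_real ((\<Sum>k\<le>n. cmod (x k)) / (real n + 1))"
    by (simp add: cesaro_def seq_abs_def)
  moreover have "0 \<le> (\<Sum>k\<le>n. cmod (x k)) / (real n + 1)"
    by (simp add: sum_nonneg)
  ultimately show ?thesis
    by (metis abs_of_nonneg norm_of_real)
qed

lemma ces_infty_iff:
  "x \<in> ces_infty \<longleftrightarrow> (\<exists>B. \<forall>n. (\<Sum>k\<le>n. cmod (x k)) / (real n + 1) \<le> B)"
  by (auto simp: ces_infty_def linfty_def bounded_iff cmod_cesaro_one_seq_abs)

lemma zero_in_ces_infty: "(\<lambda>n. 0) \<in> ces_infty"
  by (auto simp: ces_infty_iff)

lemma add_average_le:
  "(\<Sum>k\<le>n. cmod (x k + y k)) / (real n + 1)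
    \<le> (\<Sum>k\<le>n. cmod (x k)) / (real n + 1) + (\<Sum>k\<le>n. cmod (y k)) / (real n + 1)"
  unfolding add_divide_distrib [symmetric] sum.distrib [symmetric]
  by (intro divide_right_mono sum_mono norm_triangle_ineq) simp

lemma add_in_ces_infty:
  assumes "x \<in> ces_infty" "y \<in> ces_infty"
  shows "(\<lambda>n. x n + y n) \<in> ces_infty"
proof -
  obtain A B where "\<And>n. (\<Sum>k\<le>n. cmod (x k)) / (real n + 1) \<le> A"
    "\<And>n. (\<Sum>k\<le>n. cmod (y k)) / (real n + 1) \<le> B"
    using assms unfolding ces_infty_iff by blast
  then have "(\<Sum>k\<le>n. cmod (x k + y k)) / (real n + 1) \<le> A + B" for n
    by (rule order_trans [OF add_average_le add_mono])
  then show ?thesis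
    unfolding ces_infty_iff by blast
qed

lemma mult_average:
  "(\<Sum>k\<le>n. cmod (c * x k)) / (real n + 1) = cmod c * ((\<Sum>k\<le>n. cmod (x k)) / (real n + 1))"
  by (simp add: norm_mult sum_distrib_left)

lemma mult_in_ces_infty:
  assumes "x \<in> ces_infty"
  shows "(\<lambda>n. c * x n) \<in> ces_infty"
  using assms unfolding ces_infty_iff mult_average
  by (meson mult_left_mono norm_ge_zero)

lemma uminus_in_ces_infty: "x \<in> ces_infty \<Longrightarrow> (\<lambda>n. - x n) \<in> ces_infty"
  using mult_in_ces_infty [of x "-1"] by simp

lemma diff_in_ces_infty:
  "x \<in> ces_infty \<Longrightarrow> y \<in> ces_infty \<Longrightarrow> (\<lambda>n. x n - y n) \<in> ces_infty"
  using add_in_ces_infty [OF _ uminus_in_ces_infty, of x y] by simp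

typedef ces = ces_infty
  morphisms seq_of Abs_ces
  using zero_in_ces_infty by blast

setup_lifting type_definition_ces

instantiation ces :: complex_normed_vector
begin

lift_definition zero_ces :: ces is "\<lambda>n. 0"
  by (rule zero_in_ces_infty)

lift_definition plus_ces :: "ces \<Rightarrow> ces \<Rightarrow> ces" is "\<lambda>x y n. x n + y n"
  by (rule add_in_ces_infty)

lift_definition uminus_ces :: "ces \<Rightarrow> ces" is "\<lambda>x n. - x n"
  by (rule uminus_in_ces_infty)

lift_definition minus_ces :: "ces \<Rightarrow> ces \<Rightarrow> ces" is "\<lambda>x y n. x n - y n"
  by (rule diff_in_ces_infty)

lift_definition scaleC_ces :: "complex \<Rightarrow> ces \<Rightarrow> ces" is "\<lambda>c x n. c * x n"
  by (rule mult_in_ces_infty)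

lift_definition scaleR_ces :: "real \<Rightarrow> ces \<Rightarrow> ces" is "\<lambda>r x n. complex_of_real r * x n"
  by (rule mult_in_ces_infty)

lift_definition norm_ces :: "ces \<Rightarrow> real" is "\<lambda>x. linfty_norm (cesaro 1 (seq_abs x))" .

definition dist_ces :: "ces \<Rightarrow> ces \<Rightarrow> real" where
  "dist_ces x y = norm (x - y)"

definition sgn_ces :: "ces \<Rightarrow> ces" where
  "sgn_ces x = scaleR (inverse (norm x)) x"

definition uniformity_ces :: "(ces \<times> ces) filter" where
  "uniformity_ces = (INF e\<in>{0<..}. principal {(x, y). dist x y < e})"

definition open_ces :: "ces set \<Rightarrow> bool" where
  "open_ces U \<longleftrightarrow> (\<forall>x\<in>U. \<forall>\<^sub>F (x', y) in uniformity. x' = x \<longrightarrow> y \<in> U)"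

lemma norm_ces_eq: "norm x = (SUP n. (\<Sum>k\<le>n. cmod (seq_of x k)) / (real n + 1))"
  by transfer (simp add: linfty_norm_def cmod_cesaro_one_seq_abs)

lemma average_le_norm: "(\<Sum>k\<le>n. cmod (seq_of x k)) / (real n + 1) \<le> norm x"
proof -
  have "bdd_above (range (\<lambda>n. (\<Sum>k\<le>n. cmod (seq_of x k)) / (real n + 1)))"
    using seq_of [of x] by (auto simp: ces_infty_iff bdd_above_def)
  then show ?thesis
    unfolding norm_ces_eq by (rule cSUP_upper2 [OF _ UNIV_I order_refl])
qed

lemma norm_ces_le:
  "(\<And>n. (\<Sum>k\<le>n. cmod (seq_of x k)) / (real n + 1) \<le> B) \<Longrightarrow> norm (x::ces) \<le> B"
  unfolding norm_ces_eq by (rule cSUP_least) auto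

lemma norm_ces_nonneg: "0 \<le> norm (x::ces)"
  using average_le_norm [of x 0] by (simp add: order_trans [OF norm_ge_zero])

lemma norm_scaleC_le: "norm (scaleC c (x::ces)) \<le> cmod c * norm x"
proof (rule norm_ces_le)
  fix n
  have "(\<Sum>k\<le>n. cmod (seq_of (scaleC c x) k)) / (real n + 1)
      = cmod c * ((\<Sum>k\<le>n. cmod (seq_of x k)) / (real n + 1))"
    by (simp add: scaleC_ces.rep_eq mult_average del: times_divide_eq_right)
  also have "\<dots> \<le> cmod c * norm x"
    by (intro mult_left_mono average_le_norm) simp
  finally show "(\<Sum>k\<le>n. cmod (seq_of (scaleC c x) k)) / (real n + 1) \<le> cmod c * norm x" .
qed

lemma norm_scaleC_eq: "norm (scaleC c (x::ces)) = cmod c * norm x"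
proof (cases "c = 0")
  case True
  then show ?thesis
    using norm_scaleC_le [of c x] norm_ces_nonneg [of "scaleC c x"] by simp
next
  case False
  have x: "x = scaleC (inverse c) (scaleC c x)"
    using False by transfer (simp add: mult.assoc [symmetric])
  have "cmod c * norm x \<le> cmod c * (cmod (inverse c) * norm (scaleC c x))"
    using norm_scaleC_le [of "inverse c" "scaleC c x"] x
    by (intro mult_left_mono) auto
  also have "\<dots> = norm (scaleC c x)"
    using False by (simp add: norm_inverse)
  finally show ?thesis
    using norm_scaleC_le [of c x] by simp
qed

lemma scaleR_ces_eq: "scaleR r (x::ces) = scaleC (complex_of_real r) x"
  by transfer simp

instance
proof
  fix x y z :: ces and a b :: real and c d :: complex
  show "x + y + z = x + (y + z)" "x + y = y + x" "0 + x = x" "- x + x = 0"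
    "x - y = x + - y"
    by (transfer; simp add: algebra_simps)+
  show "a *\<^sub>R (x + y) = a *\<^sub>R x + a *\<^sub>R y" "(a + b) *\<^sub>R x = a *\<^sub>R x + b *\<^sub>R x"
    "a *\<^sub>R b *\<^sub>R x = (a * b) *\<^sub>R x" "1 *\<^sub>R x = x"
    by (transfer; simp add: algebra_simps)+
  show "scaleC c (x + y) = scaleC c x + scaleC c y"
    "scaleC (c + d) x = scaleC c x + scaleC d x"
    "scaleC c (scaleC d x) = scaleC (c * d) x" "scaleC 1 x = x"
    by (transfer; simp add: algebra_simps)+
  show "a *\<^sub>R x = scaleC (complex_of_real a) x"
    by (rule scaleR_ces_eq)
  show "norm (scaleC c x) = cmod c * norm x"
    by (rule norm_scaleC_eq)
  show "norm (a *\<^sub>R x) = \<bar>a\<bar> * norm x"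
    by (simp add: scaleR_ces_eq norm_scaleC_eq)
  show "dist x y = norm (x - y)"
    by (rule dist_ces_def)
  show "sgn x = scaleR (inverse (norm x)) x"
    by (rule sgn_ces_def)
  show "uniformity = (INF e\<in>{0<..}. principal {(x, y::ces). dist x y < e})"
    by (rule uniformity_ces_def)
  show "open U \<longleftrightarrow> (\<forall>x\<in>U. \<forall>\<^sub>F (x', y) in uniformity. x' = x \<longrightarrow> y \<in> U)" for U :: "ces set"
    by (rule open_ces_def)
  show "norm x = 0 \<longleftrightarrow> x = 0"
  proof
    assume x: "norm x = 0"
    have "cmod (seq_of x n) = 0" for n
    proof -
      have "(\<Sum>k\<le>n. cmod (seq_of x k)) \<le> 0"
        using average_le_norm [of x n] x by (simp add: divide_le_0_iff)
      moreover have "cmod (seq_of x n) \<le> (\<Sum>k\<le>n. cmod (seq_of x k))"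
        by (rule member_le_sum) auto
      ultimately show ?thesis
        using norm_ge_zero [of "seq_of x n"] by linarith
    qed
    then have "seq_of x = (\<lambda>n. 0)"
      by auto
    then show "x = 0"
      by (simp add: seq_of_inject [symmetric] zero_ces.rep_eq)
  next
    assume "x = 0"
    then show "norm x = 0"
      by (simp add: norm_ces_eq zero_ces.rep_eq)
  qed
  show "norm (x + y) \<le> norm x + norm y"
  proof (rule norm_ces_le)
    fix n
    show "(\<Sum>k\<le>n. cmod (seq_of (x + y) k)) / (real n + 1) \<le> norm x + norm y"
      unfolding plus_ces.rep_eq
      by (rule order_trans [OF add_average_le add_mono [OF average_le_norm average_le_norm]])
  qed
qed

end

text \<open>
  The restriction of \<open>cesaro t\<close> to \<open>ces\<^sub>\<infinity>\<close>. It is meaningful only if \<open>cesaro t\<close> maps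
  \<open>ces_infty\<close> into itself, since \<open>Abs_ces\<close> is unspecified outside \<open>ces_infty\<close>.
\<close>

definition cesaro_ces :: "real \<Rightarrow> ces \<Rightarrow> ces" where
  "cesaro_ces t x = Abs_ces (cesaro t (seq_of x))"

definition Lambda :: "complex set" where
  "Lambda = {1 / (of_nat n + 1) | n :: nat. True}"

end

theory Submission
  imports Defs "HOL-Real_Asymp.Real_Asymp"
begin

text \<open>
  The identity behind everything is that \<open>z = cesaro t x\<close> holds iff \<open>z 0 = x 0\<close> and
  \<open>(n + 2) z (n + 1) = t (n + 1) z n + x (n + 1)\<close> for all \<open>n\<close> (\<open>cesaro_eq_iff\<close>). So
  \<open>cesaro t\<close> is \<open>D S\<close>, where \<open>S\<close> solves the recurrence \<open>y (n + 1) = t y n + x (n + 1)\<close> and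
  \<open>D\<close> divides the \<open>n\<close>-th entry by \<open>n + 1\<close>. Because \<open>t < 1\<close>, such recurrences are
  contractive: the partial sums of the moduli of the solution are at most a constant times those
  of the data, even if the coefficient \<open>t\<close> is replaced by a sequence converging to \<open>t\<close>
  (\<open>summed_bound_of_recurrence\<close>). Partial sums of moduli are what the norm of \<open>ces\<^sub>\<infinity>\<close> is
  made of, so this one estimate turns recurrences into norm bounds, in three places.

  \<^item> Applied to \<open>S\<close>, it shows that the part of \<open>cesaro t x\<close> beyond index \<open>N\<close> has norm
    \<open>O(norm x / (N + 1))\<close> (\<open>sum_norm_cesaro_le\<close>). Hence coordinatewise convergence of a bounded
    sequence becomes norm convergence under the operator, and Tychonoff's theorem gives compactness.
    The same estimate shows that every element of the range is a norm limit of finitely supported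
    sequences; the constant sequence \<open>1\<close> is not, so the range is not dense and \<open>0\<close> is in
    the residual spectrum.

  \<^item> For \<open>\<mu> = 1 / (m + 1)\<close>, the eigenvalue equation is \<open>(n - m) x n = t n x (n - 1)\<close>, with
    solution \<open>x n = (n choose m) t ^ (n - m)\<close>. The ratio of consecutive entries tends to \<open>t\<close>,
    so the solution lies in \<open>ces\<^sub>\<infinity>\<close>.

  \<^item> For \<open>\<mu> \<notin> Lambda \<union> {0}\<close>, the equation \<open>cesaro t x - \<mu> x = b\<close> is a recurrence for
    \<open>x\<close> whose leading coefficients \<open>(n + 1) \<mu> - 1\<close> do not vanish. It is thus solvable,
    and after division by them the coefficient of \<open>x n\<close> tends to \<open>t\<close>, so the estimate
    bounds \<open>x\<close> by \<open>b\<close>, and the inverse is bounded.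

  The operator norm is at most \<open>1\<close> since the modulus of each entry of \<open>cesaro t x\<close> is bounded by the
  average of the moduli of \<open>x\<close> up to that index, and it is \<open>1\<close> since \<open>1\<close> is an eigenvalue.
\<close>

section \<open>Summed bounds for contractive recurrences\<close>

text \<open>
  A discrete Gronwall inequality. Beyond some index the coefficients are at most \<open>r < 1\<close>, and
  there \<open>sum u {..n} + q * u n\<close> with \<open>q = r / (1 - r)\<close> grows in each step by at most
  \<open>v (Suc n) / (1 - r)\<close>: the weight \<open>q\<close> is the geometric series \<open>r + r\<^sup>2 + \<dots>\<close>, the total
  that \<open>u n\<close> can still contribute. The finitely many earlier indices cost only a constant
  factor. That \<open>K\<close> depends on \<open>A\<close> alone is what makes the bound an operator bound later.
\<close>
lemma summed_bound_of_recurrence: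
  fixes A :: "nat \<Rightarrow> real"
  assumes A: "A \<longlonglongrightarrow> a" and a: "a < 1"
  obtains K where "K \<ge> 0"
    "\<And>u v n. (\<And>n. 0 \<le> u n) \<Longrightarrow> (\<And>n. 0 \<le> v n) \<Longrightarrow> u 0 \<le> v 0
        \<Longrightarrow> (\<And>n. u (Suc n) \<le> A n * u n + v (Suc n))
        \<Longrightarrow> sum u {..n} \<le> K * sum v {..n}"
proof -
  obtain r where r: "max a 0 < r" "r < 1"
    using a dense[of "max a 0" 1] by auto
  have "eventually (\<lambda>n. A n < r) sequentially"
    using order_tendstoD(2)[OF A, of r] r by simp
  then obtain N where N: "\<And>n. n \<ge> N \<Longrightarrow> A n \<le> r"
    by (force simp: eventually_sequentially)
  have "Bseq A"
    using A by (blast intro: convergent_imp_Bseq convergentI)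
  then obtain B where B: "B > 0" "\<And>n. A n \<le> B"
    by (auto simp: Bseq_def) (metis abs_le_D1)
  define q where "q = r / (1 - r)"
  define K where "K = (2 + B) ^ N / (1 - r)"
  have q: "q \<ge> 0" "1 + q = 1 / (1 - r)" "(1 + q) * r = q"
    using r by (simp_all add: q_def field_simps)
  have K: "K \<ge> 0" "1 + q \<le> K"
    using r B(1) by (simp_all add: K_def q(2) divide_le_cancel)
  show thesis
  proof
    fix u v :: "nat \<Rightarrow> real" and n :: nat
    assume u: "\<And>n. 0 \<le> u n" and v: "\<And>n. 0 \<le> v n" and u0: "u 0 \<le> v 0"
      and rec: "\<And>n. u (Suc n) \<le> A n * u n + v (Suc n)"
    have U: "u n \<le> sum u {..n}" for n
      using u by (intro member_le_sum) auto
    have V: "0 \<le> sum v {..n}" for n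
      using v by (intro sum_nonneg) auto
    have start: "sum u {..n} \<le> (2 + B) ^ n * sum v {..n}" for n
    proof (induction n)
      case 0
      then show ?case using u0 by simp
    next
      case (Suc n)
      have "u (Suc n) \<le> B * sum u {..n} + v (Suc n)"
        using rec[of n] mult_right_mono[OF B(2) u, of n n] mult_left_mono[OF U, of B n] B(1)
        by linarith
      then have "sum u {..Suc n} \<le> (1 + B) * sum u {..n} + v (Suc n)"
        by (simp add: algebra_simps)
      also have "\<dots> \<le> (1 + B) * ((2 + B) ^ n * sum v {..n}) + v (Suc n)"
        using Suc.IH B(1) by simp
      also have "\<dots> \<le> (2 + B) ^ Suc n * sum v {..Suc n}"
      proof -
        have "1 * v (Suc n) \<le> (2 + B) ^ Suc n * v (Suc n)"
          using B(1) v by (intro mult_right_mono one_le_power) auto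
        moreover have "(1 + B) * ((2 + B) ^ n * sum v {..n}) \<le> (2 + B) * ((2 + B) ^ n * sum v {..n})"
          using B(1) V by (intro mult_right_mono) auto
        ultimately show ?thesis
          by (simp add: algebra_simps)
      qed
      finally show ?case .
    qed
    show "sum u {..n} \<le> K * sum v {..n}"
    proof (cases "n \<le> N")
      case True
      have "(2 + B) ^ n \<le> (2 + B) ^ N / 1"
        using True B(1) by (simp add: power_increasing)
      also have "\<dots> \<le> K"
        unfolding K_def using r B(1) by (intro divide_left_mono) auto
      finally show ?thesis
        using start[of n] mult_right_mono[OF _ V] by (meson order_trans)
    next
      case False
      have "sum u {..n} + q * u n \<le> K * sum v {..n}"
        if "n \<ge> N" for n
        using that
      proof (induction n rule: dec_induct)
        case base
        have "sum u {..N} + q * u N \<le> (1 + q) * sum u {..N}"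
          using mult_left_mono[OF U q(1), of N] by (simp add: algebra_simps)
        also have "\<dots> \<le> (1 + q) * ((2 + B) ^ N * sum v {..N})"
          using start[of N] q(1) by (intro mult_left_mono) auto
        also have "\<dots> = K * sum v {..N}"
          by (simp add: K_def q(2))
        finally show ?case .
      next
        case (step n)
        have "u (Suc n) \<le> r * u n + v (Suc n)"
          using rec[of n] mult_right_mono[OF N[OF step.hyps(1)] u[of n]] by linarith
        then have "(1 + q) * u (Suc n) \<le> (1 + q) * (r * u n + v (Suc n))"
          using q(1) by (intro mult_left_mono) auto
        also have "\<dots> = q * u n + (1 + q) * v (Suc n)"
          unfolding distrib_left mult.assoc[symmetric] q(3) ..
        also have "\<dots> \<le> q * u n + K * v (Suc n)"
          using mult_right_mono[OF K(2) v] by simp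
        finally show ?case
          using step.IH by (simp add: algebra_simps)
      qed
      then have "sum u {..n} + q * u n \<le> K * sum v {..n}"
        using False by simp
      then show ?thesis
        using mult_nonneg_nonneg[OF q(1) u[of n]] by linarith
    qed
  qed (rule K(1))
qed

section \<open>The Cesaro recurrence\<close>

lemma of_nat_plus_neq_0: "(of_nat n + 1 :: complex) \<noteq> 0" "(of_nat n + 2 :: complex) \<noteq> 0"
  using of_nat_neq_0[of n, where ?'a=complex] of_nat_neq_0[of "Suc n", where ?'a=complex]
  by (simp_all add: algebra_simps)

lemma norm_of_nat_plus: "cmod (of_nat n + 1) = real n + 1" "cmod (of_nat n + 2) = real n + 2"
  using norm_of_nat[of "n + 1", where ?'a=complex] norm_of_nat[of "n + 2", where ?'a=complex]
  by (simp_all add: add.commute)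

lemma cesaro_0: "cesaro t x 0 = x 0"
  by (simp add: cesaro_def)

lemma cesaro_Suc:
  "(of_nat n + 2) * cesaro t x (Suc n)
    = of_real t * (of_nat n + 1) * cesaro t x n + x (Suc n)"
proof -
  note nz = of_nat_plus_neq_0[of n]
  have s: "(of_nat n + 2) * cesaro t x (Suc n)
      = (\<Sum>k\<le>Suc n. complex_of_real t ^ (Suc n - k) * x k)"
    using nz by (simp add: cesaro_def add.commute del: sum.atMost_Suc)
  have "(\<Sum>k\<le>Suc n. complex_of_real t ^ (Suc n - k) * x k)
     = of_real t * (\<Sum>k\<le>n. complex_of_real t ^ (n - k) * x k) + x (Suc n)"
    by (simp add: sum_distrib_left Suc_diff_le mult.assoc)
  also have "(\<Sum>k\<le>n. complex_of_real t ^ (n - k) * x k) = (of_nat n + 1) * cesaro t x n"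
    using nz by (simp add: cesaro_def)
  finally show ?thesis
    using s by (simp add: mult.assoc)
qed

text \<open>
  Since the recurrence determines its solution, equations involving \<open>cesaro t\<close> can be checked and
  solved entry by entry.
\<close>
lemma cesaro_eq_iff:
  "cesaro t x = z \<longleftrightarrow> z 0 = x 0 \<and>
    (\<forall>n. (of_nat n + 2) * z (Suc n) = of_real t * (of_nat n + 1) * z n + x (Suc n))"
  (is "_ \<longleftrightarrow> ?R")
proof
  assume "cesaro t x = z"
  then show ?R using cesaro_0 cesaro_Suc by auto
next
  assume R: ?R
  have "cesaro t x n = z n" for n
  proof (induction n)
    case 0
    then show ?case using R by (simp add: cesaro_0)
  next
    case (Suc n)
    have "(of_nat n + 2) * cesaro t x (Suc n) = (of_nat n + 2) * z (Suc n)"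
      using R Suc by (simp add: cesaro_Suc)
    then show ?case
      using of_nat_plus_neq_0(2)[of n] by simp
  qed
  then show "cesaro t x = z" by auto
qed

text \<open>
  As \<open>t ^ (n - k) \<le> 1\<close>, the operator is dominated by \<open>cesaro 1\<close> applied to moduli, which maps
  \<open>ces\<^sub>\<infinity>\<close> into \<open>\<ell>\<^sup>\<infinity>\<close> with norm one; and averages of a bounded sequence obey the same
  bound. This gives invariance of \<open>ces\<^sub>\<infinity>\<close> and the bound \<open>1\<close> for the operator norm.
\<close>
lemma norm_cesaro_le_average:
  assumes "0 \<le> t" "t \<le> 1"
  shows "cmod (cesaro t x n) \<le> (\<Sum>k\<le>n. cmod (x k)) / (real n + 1)"
proof -
  have "cmod (cesaro t x n)
      = cmod (\<Sum>k\<le>n. complex_of_real t ^ (n - k) * x k) / (real n + 1)"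
    by (simp add: cesaro_def norm_mult norm_divide norm_of_nat_plus)
  also have "\<dots> \<le> (\<Sum>k\<le>n. cmod (x k)) / (real n + 1)"
  proof (intro divide_right_mono order_trans[OF norm_sum] sum_mono)
    fix k
    have "t ^ (n - k) \<le> 1" using assms by (intro power_le_one)
    then show "cmod (complex_of_real t ^ (n - k) * x k) \<le> cmod (x k)"
      using assms by (simp add: norm_mult norm_power mult_left_le_one_le)
  qed simp
  finally show ?thesis .
qed

lemma bounded_in_ces_infty:
  assumes "\<And>n. cmod (x n) \<le> B"
  shows "x \<in> ces_infty"
proof -
  have "(\<Sum>k\<le>n. cmod (x k)) / (real n + 1) \<le> B" for n
    using sum_bounded_above[of "{..n}" "\<lambda>k. cmod (x k)" B] assms
    by (simp add: divide_le_eq algebra_simps)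
  then show ?thesis unfolding ces_infty_iff by blast
qed

lemma cesaro_in_ces_infty:
  assumes "0 \<le> t" "t \<le> 1" "x \<in> ces_infty"
  shows "cesaro t x \<in> ces_infty"
proof -
  obtain B where "\<And>n. (\<Sum>k\<le>n. cmod (x k)) / (real n + 1) \<le> B"
    using assms(3) unfolding ces_infty_iff by blast
  then have "cmod (cesaro t x n) \<le> B" for n
    using norm_cesaro_le_average[OF assms(1,2)] order_trans by blast
  then show ?thesis by (rule bounded_in_ces_infty)
qed

section \<open>The operator on the Banach space\<close>

lemma cont_lin_opsI:
  assumes add: "\<And>x y. T (x + y) = T x + T y"
    and scale: "\<And>c x. T (c *\<^sub>C x) = c *\<^sub>C T x"
    and bound: "\<And>x. norm (T x) \<le> K * norm x"
  shows "T \<in> cont_lin_ops"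
proof -
  have "bounded_linear T"
    by (rule bounded_linear_intro[where K=K])
      (use assms in \<open>simp_all add: scaleR_scaleC mult.commute\<close>)
  then have "continuous_on UNIV T"
    by (rule linear_continuous_on)
  moreover have "Vector_Spaces.linear scaleC scaleC T"
    unfolding Vector_Spaces.linear_iff using add scale vector_space_scaleC by blast
  ultimately show ?thesis by (simp add: cont_lin_ops_def)
qed

lemma sum_le_norm: "(\<Sum>k\<le>n. cmod (seq_of x k)) \<le> (real n + 1) * norm x"
  using average_le_norm[of x n] by (simp add: divide_le_eq mult.commute)

lemma norm_ces_leI:
  assumes "\<And>n. (\<Sum>k\<le>n. cmod (seq_of x k)) \<le> (real n + 1) * B"
  shows "norm x \<le> B"
  using assms by (intro norm_ces_le) (simp add: divide_le_eq mult.commute)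

lemma ces_eqI: "(\<And>n. seq_of x n = seq_of y n) \<Longrightarrow> x = y"
  by (simp add: seq_of_inject[symmetric] fun_eq_iff)

lemma cesaro_add: "cesaro t (\<lambda>n. x n + y n) n = cesaro t x n + cesaro t y n"
  by (simp add: cesaro_def algebra_simps sum.distrib)

lemma cesaro_mult: "cesaro t (\<lambda>n. c * x n) n = c * cesaro t x n"
  by (simp add: cesaro_def sum_distrib_left mult.left_commute)

context
  fixes t :: real
  assumes t0: "0 \<le> t" and t1: "t \<le> 1"
begin

lemma seq_of_cesaro_ces: "seq_of (cesaro_ces t x) = cesaro t (seq_of x)"
  unfolding cesaro_ces_def
  using cesaro_in_ces_infty[OF t0 t1 seq_of] by (simp add: Abs_ces_inverse)

lemma norm_cesaro_ces_le: "norm (cesaro_ces t x) \<le> norm x"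
proof (rule norm_ces_leI)
  fix n
  have "cmod (seq_of (cesaro_ces t x) k) \<le> norm x" for k
    using norm_cesaro_le_average[OF t0 t1] average_le_norm order_trans
    unfolding seq_of_cesaro_ces by blast
  then show "(\<Sum>k\<le>n. cmod (seq_of (cesaro_ces t x) k)) \<le> (real n + 1) * norm x"
    using sum_bounded_above[of "{..n}" "\<lambda>k. cmod (seq_of (cesaro_ces t x) k)" "norm x"]
    by (simp add: algebra_simps)
qed

lemma cesaro_ces_add: "cesaro_ces t (x + y) = cesaro_ces t x + cesaro_ces t y"
  by (rule ces_eqI) (simp add: seq_of_cesaro_ces plus_ces.rep_eq cesaro_add)

lemma cesaro_ces_scaleC: "cesaro_ces t (c *\<^sub>C x) = c *\<^sub>C cesaro_ces t x"
  by (rule ces_eqI) (simp add: seq_of_cesaro_ces scaleC_ces.rep_eq cesaro_mult)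

lemma bounded_linear_cesaro_ces: "bounded_linear (cesaro_ces t)"
  by (rule bounded_linear_intro[where K=1])
    (simp_all add: cesaro_ces_add cesaro_ces_scaleC scaleR_scaleC norm_cesaro_ces_le)

lemma cesaro_ces_in_cont_lin_ops: "cesaro_ces t \<in> cont_lin_ops"
  by (rule cont_lin_opsI[where K=1])
    (simp_all add: cesaro_ces_add cesaro_ces_scaleC norm_cesaro_ces_le)

lemma seq_of_shifted: "seq_of (shifted (cesaro_ces t) \<mu> x) n
    = cesaro t (seq_of x) n - \<mu> * seq_of x n"
  by (simp add: shifted_def minus_ces.rep_eq scaleC_ces.rep_eq seq_of_cesaro_ces)

lemma shifted_add: "shifted (cesaro_ces t) \<mu> (x + y)
    = shifted (cesaro_ces t) \<mu> x + shifted (cesaro_ces t) \<mu> y"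
  by (simp add: shifted_def cesaro_ces_add scaleC_add_right)

lemma shifted_scaleC: "shifted (cesaro_ces t) \<mu> (c *\<^sub>C x) = c *\<^sub>C shifted (cesaro_ces t) \<mu> x"
  by (rule ces_eqI) (simp add: seq_of_shifted scaleC_ces.rep_eq cesaro_mult algebra_simps)

end


section \<open>Compactness and the range\<close>

text \<open>
  The scaled entries \<open>u k = (k + 1) \<bar>cesaro t x k\<bar>\<close> satisfy \<open>u (k + 1) \<le> t * u k + \<bar>x (k + 1)\<bar>\<close>,
  so their averages are \<open>O(norm x)\<close>; beyond index \<open>N\<close> the division by \<open>k + 1\<close> gains a factor
  \<open>1 / (N + 1)\<close>. Thus the operator is a norm limit of truncations, and finitely many coordinates of
  \<open>cesaro t x\<close> control its norm up to a small multiple of \<open>norm x\<close>.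
\<close>
lemma sum_norm_cesaro_le:
  assumes "0 \<le> t" "t < 1"
  obtains K where "K \<ge> 0"
    "\<And>x N n. (\<Sum>k\<le>n. cmod (cesaro t (seq_of x) k))
      \<le> (\<Sum>k<N. cmod (cesaro t (seq_of x) k)) + (real n + 1) * (K * norm x / (real N + 1))"
proof -
  obtain K where K: "K \<ge> 0"
    "\<And>u v n. (\<And>n. 0 \<le> u n) \<Longrightarrow> (\<And>n. 0 \<le> v n) \<Longrightarrow> u 0 \<le> v 0
        \<Longrightarrow> (\<And>n. u (Suc n) \<le> t * u n + v (Suc n))
        \<Longrightarrow> sum u {..n} \<le> K * sum v {..n}"
    using summed_bound_of_recurrence[OF tendsto_const[of t] assms(2)] by metis
  show thesis
  proof
    fix x :: ces and N n :: nat
    let ?z = "\<lambda>k. cmod (cesaro t (seq_of x) k)"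
    define u where "u k = (real k + 1) * ?z k" for k
    have u0: "u k \<ge> 0" for k by (simp add: u_def)
    have "sum u {..n} \<le> K * (\<Sum>k\<le>n. cmod (seq_of x k))"
    proof (rule K(2))
      fix k
      have "u (Suc k) = cmod ((of_nat k + 2) * cesaro t (seq_of x) (Suc k))"
        by (simp add: u_def norm_mult norm_of_nat_plus)
      also have "\<dots> \<le> cmod (of_real t * (of_nat k + 1) * cesaro t (seq_of x) k)
          + cmod (seq_of x (Suc k))"
        unfolding cesaro_Suc by (rule norm_triangle_ineq)
      also have "cmod (of_real t * (of_nat k + 1) * cesaro t (seq_of x) k) = t * u k"
        using assms by (simp add: norm_mult u_def norm_of_nat_plus)
      finally show "u (Suc k) \<le> t * u k + cmod (seq_of x (Suc k))" .
    qed (simp_all add: u_def cesaro_0)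
    also have "\<dots> \<le> K * ((real n + 1) * norm x)"
      by (intro mult_left_mono sum_le_norm K)
    finally have U: "sum u {..n} \<le> K * ((real n + 1) * norm x)" .
    have "sum ?z {..n} = sum ?z ({..n} \<inter> {..<N}) + sum ?z ({..n} - {..<N})"
      by (rule sum.Int_Diff) simp
    moreover have "sum ?z ({..n} \<inter> {..<N}) \<le> sum ?z {..<N}"
      by (rule sum_mono2) auto
    moreover have "sum ?z ({..n} - {..<N}) \<le> sum u {..n} / (real N + 1)"
    proof -
      have "sum ?z ({..n} - {..<N}) \<le> (\<Sum>k\<in>{..n} - {..<N}. u k / (real N + 1))"
      proof (rule sum_mono)
        fix k assume "k \<in> {..n} - {..<N}"
        then have "(real N + 1) * ?z k \<le> u k"
          unfolding u_def by (intro mult_right_mono) auto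
        then show "?z k \<le> u k / (real N + 1)"
          by (simp add: le_divide_eq mult.commute)
      qed
      also have "\<dots> \<le> (\<Sum>k\<le>n. u k / (real N + 1))"
        by (rule sum_mono2) (auto simp: u0)
      finally show ?thesis by (simp add: sum_divide_distrib)
    qed
    moreover have "sum u {..n} / (real N + 1) \<le> (real n + 1) * (K * norm x / (real N + 1))"
      using divide_right_mono[OF U, of "real N + 1"] by (simp add: algebra_simps)
    ultimately show "sum ?z {..n}
      \<le> (\<Sum>k<N. cmod (cesaro t (seq_of x) k)) + (real n + 1) * (K * norm x / (real N + 1))"
      by linarith
  qed (rule K(1))
qed

lemma ex_divide_Suc_le:
  fixes C e :: real
  assumes "0 < e"
  shows "\<exists>N. C / (real N + 1) \<le> e"
proof -
  obtain N where "C / e < real N" using reals_Archimedean2 by blast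
  then have "C / (real N + 1) \<le> e"
    using assms by (simp add: field_simps)
  then show ?thesis ..
qed

text \<open>
  The ball of \<open>ces\<^sub>\<infinity>\<close> is compact for coordinatewise convergence: its entries are bounded at
  each index, so Tychonoff's theorem applies, and it is cut out by conditions on finitely many
  coordinates each.
\<close>
lemma compact_bounded_averages:
  "compact {x :: nat \<Rightarrow> complex. \<forall>n. (\<Sum>k\<le>n. cmod (x k)) \<le> (real n + 1) * R}"
  (is "compact ?K")
proof -
  define P where "P = PiE UNIV (\<lambda>n. cball (0::complex) ((real n + 1) * R))"
  have "compactin euclidean P"
    unfolding P_def euclidean_product_topology[symmetric] compactin_PiE by simp
  moreover have "closed ?K"
    by (intro closed_Collect_all closed_Collect_le continuous_intros
        continuous_on_product_coordinates)
  ultimately have "compact (P \<inter> ?K)"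
    by (simp add: compact_Int_closed)
  moreover have "P \<inter> ?K = ?K"
  proof (rule inf.absorb2, rule subsetI)
    fix x assume "x \<in> ?K"
    moreover have "cmod (x n) \<le> (\<Sum>k\<le>n. cmod (x k))" for n
      by (intro member_le_sum) auto
    ultimately have "cmod (x n) \<le> (real n + 1) * R" for n
      using order_trans by blast
    then show "x \<in> P"
      by (simp add: P_def PiE_UNIV_domain)
  qed
  ultimately show ?thesis by simp
qed

text \<open>
  On a ball, coordinatewise convergence of \<open>x\<close> implies norm convergence of \<open>cesaro t x\<close>, by the
  tail estimate. So the image of the ball is the continuous image of a compact set, hence compact,
  and it contains the closure of the image of every subset.
\<close>
lemma compact_op_cesaro_ces:
  assumes t: "0 \<le> t" "t < 1"
  shows "compact_op (cesaro_ces t)"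
  unfolding compact_op_def
proof (intro conjI allI impI)
  show "cesaro_ces t \<in> cont_lin_ops"
    using t by (intro cesaro_ces_in_cont_lin_ops) auto
next
  fix B :: "ces set"
  assume "bounded B"
  then obtain R where R: "\<And>x. x \<in> B \<Longrightarrow> norm x \<le> R"
    by (auto simp: bounded_iff)
  define Q where "Q = {x :: nat \<Rightarrow> complex. \<forall>n. (\<Sum>k\<le>n. cmod (x k)) \<le> (real n + 1) * R}"
  have Q: "x \<in> ces_infty" if "x \<in> Q" for x
    using that unfolding Q_def ces_infty_iff
    by (auto simp: divide_le_eq mult.commute intro!: exI[of _ R])
  have Q_norm: "norm (Abs_ces x) \<le> R" if "x \<in> Q" for x
    using that Q[OF that] by (intro norm_ces_leI) (auto simp: Q_def Abs_ces_inverse)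
  obtain K where K: "K \<ge> 0"
    "\<And>x N n. (\<Sum>k\<le>n. cmod (cesaro t (seq_of x) k))
      \<le> (\<Sum>k<N. cmod (cesaro t (seq_of x) k)) + (real n + 1) * (K * norm x / (real N + 1))"
    using sum_norm_cesaro_le[OF t] by metis
  have t': "t \<le> 1" using t by simp
  have "continuous_on Q (\<lambda>x. cesaro_ces t (Abs_ces x))"
  proof (rule continuous_on_sequentiallyI)
    fix X :: "nat \<Rightarrow> nat \<Rightarrow> complex" and a
    assume X: "\<forall>j. X j \<in> Q" and a: "a \<in> Q" and lim: "X \<longlonglongrightarrow> a"
    have coord: "(\<lambda>j. X j k) \<longlonglongrightarrow> a k" for k
      using continuous_on_tendsto_compose[OF continuous_on_product_coordinates[of k] lim]
      by simp
    let ?D = "\<lambda>j. Abs_ces (X j) - Abs_ces a"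
    have D: "cesaro_ces t (Abs_ces (X j)) - cesaro_ces t (Abs_ces a) = cesaro_ces t (?D j)" for j
      using bounded_linear_cesaro_ces[OF t(1) t'] by (simp add: linear_diff bounded_linear.linear)
    have Dn: "norm (?D j) \<le> 2 * R" for j
      using norm_triangle_ineq4[of "Abs_ces (X j)" "Abs_ces a"] Q_norm[of "X j"] Q_norm[OF a] X
      by force
    have Ds: "seq_of (?D j) = (\<lambda>n. X j n - a n)" for j
      using X a Q by (simp add: minus_ces.rep_eq Abs_ces_inverse)
    have coord': "(\<lambda>j. cesaro t (seq_of (?D j)) k) \<longlonglongrightarrow> 0" for k
    proof -
      have "(\<lambda>j. cesaro t (seq_of (?D j)) k) \<longlonglongrightarrow> cesaro t (\<lambda>n. a n - a n) k"
        unfolding Ds cesaro_def by (intro tendsto_intros coord)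
      then show ?thesis by (simp add: cesaro_def)
    qed
    show "(\<lambda>j. cesaro_ces t (Abs_ces (X j))) \<longlonglongrightarrow> cesaro_ces t (Abs_ces a)"
    proof (rule tendstoI)
      fix e :: real assume e: "0 < e"
      obtain N where N: "K * (2 * R) / (real N + 1) \<le> e / 2"
        using ex_divide_Suc_le[of "e / 2" "K * (2 * R)"] e by (meson half_gt_zero)
      have "(\<lambda>j. \<Sum>k<N. cmod (cesaro t (seq_of (?D j)) k)) \<longlonglongrightarrow> (\<Sum>k<N. 0)"
        by (intro tendsto_sum tendsto_norm_zero coord')
      then have "eventually (\<lambda>j. (\<Sum>k<N. cmod (cesaro t (seq_of (?D j)) k)) < e / 2) sequentially"
        using e by (intro order_tendstoD(2)) auto
      then show "eventually (\<lambda>j. dist (cesaro_ces t (Abs_ces (X j))) (cesaro_ces t (Abs_ces a)) < e)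
          sequentially"
      proof (rule eventually_mono)
        fix j
        let ?S = "\<Sum>k<N. cmod (cesaro t (seq_of (?D j)) k)"
        assume S: "?S < e / 2"
        have S0: "?S \<ge> 0" by (simp add: sum_nonneg)
        have "norm (cesaro_ces t (?D j)) \<le> ?S + e / 2"
        proof (rule norm_ces_leI)
          fix n
          have "K * norm (?D j) / (real N + 1) \<le> K * (2 * R) / (real N + 1)"
            using K(1) Dn by (intro divide_right_mono mult_left_mono) auto
          then have "K * norm (?D j) / (real N + 1) \<le> e / 2"
            using N by (rule order_trans)
          then have "(real n + 1) * (K * norm (?D j) / (real N + 1)) \<le> (real n + 1) * (e / 2)"
            by (rule mult_left_mono) simp
          moreover have "1 * ?S \<le> (real n + 1) * ?S"
            using S0 by (intro mult_right_mono) auto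
          ultimately show "(\<Sum>k\<le>n. cmod (seq_of (cesaro_ces t (?D j)) k))
              \<le> (real n + 1) * (?S + e / 2)"
            using K(2)[where x="?D j" and N=N and n=n]
            unfolding seq_of_cesaro_ces[OF t(1) t'] distrib_left by linarith
        qed
        then show "dist (cesaro_ces t (Abs_ces (X j))) (cesaro_ces t (Abs_ces a)) < e"
          using S by (simp add: dist_norm D)
      qed
    qed
  qed
  then have cpt: "compact ((\<lambda>x. cesaro_ces t (Abs_ces x)) ` Q)"
    unfolding Q_def by (rule compact_continuous_image[OF _ compact_bounded_averages])
  moreover have "cesaro_ces t ` B \<subseteq> (\<lambda>x. cesaro_ces t (Abs_ces x)) ` Q"
  proof (rule image_subsetI)
    fix x assume "x \<in> B"
    then have "seq_of x \<in> Q"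
      using order_trans[OF sum_le_norm mult_left_mono[OF R]] by (simp add: Q_def)
    then show "cesaro_ces t x \<in> (\<lambda>x. cesaro_ces t (Abs_ces x)) ` Q"
      by (intro image_eqI[where x="seq_of x"]) (simp_all add: seq_of_inverse)
  qed
  ultimately have "closure (cesaro_ces t ` B) \<subseteq> (\<lambda>x. cesaro_ces t (Abs_ces x)) ` Q"
    by (intro closure_minimal compact_imp_closed)
  then show "compact (closure (cesaro_ces t ` B))"
    using compact_Int_closed[OF cpt closed_closure, of "cesaro_ces t ` B"] by (simp add: inf.absorb2)
qed

text \<open>
  By the tail estimate the averages of \<open>\<bar>cesaro t x k\<bar>\<close> tend to \<open>0\<close>, so the constant sequence
  \<open>1\<close>, all of whose averages are \<open>1\<close>, stays at a fixed distance from the range.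
\<close>
lemma range_cesaro_ces_not_dense:
  assumes t: "0 \<le> t" "t < 1"
  shows "closure (range (cesaro_ces t)) \<noteq> UNIV"
proof -
  obtain K where K: "K \<ge> 0"
    "\<And>x N n. (\<Sum>k\<le>n. cmod (cesaro t (seq_of x) k))
      \<le> (\<Sum>k<N. cmod (cesaro t (seq_of x) k)) + (real n + 1) * (K * norm x / (real N + 1))"
    using sum_norm_cesaro_le[OF t] by metis
  define e where "e = Abs_ces (\<lambda>n. 1)"
  have e: "seq_of e = (\<lambda>n. 1)"
    using bounded_in_ces_infty[of "\<lambda>n. 1" 1] by (simp add: e_def Abs_ces_inverse)
  have dist: "1 / 2 \<le> dist (cesaro_ces t x) e" for x
  proof -
    \<comment> \<open>Tail and initial part each contribute at most \<open>1 / 4\<close> to the average over \<open>{..n}\<close>.\<close>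
    obtain N where N: "K * norm x / (real N + 1) \<le> 1 / 4"
      using ex_divide_Suc_le[of "1 / 4" "K * norm x"] by auto
    let ?z = "cesaro t (seq_of x)"
    obtain n where n: "4 * (\<Sum>k<N. cmod (?z k)) \<le> real n"
      using real_arch_simple by blast
    have "(\<Sum>k\<le>n. cmod (?z k)) \<le> (\<Sum>k<N. cmod (?z k)) + (real n + 1) * (K * norm x / (real N + 1))"
      by (rule K(2))
    also have "\<dots> \<le> (real n + 1) / 4 + (real n + 1) * (1 / 4)"
      using n N by (intro add_mono mult_left_mono) auto
    finally have small: "(\<Sum>k\<le>n. cmod (?z k)) \<le> (real n + 1) / 2" by simp
    have "(real n + 1) * (1 / 2) \<le> real n + 1 - (\<Sum>k\<le>n. cmod (?z k))"
      using small by (simp add: field_simps)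
    also have "real n + 1 - (\<Sum>k\<le>n. cmod (?z k)) = (\<Sum>k\<le>n. 1 - cmod (?z k))"
      by (simp add: sum_subtractf)
    also have "\<dots> \<le> (\<Sum>k\<le>n. cmod (seq_of (cesaro_ces t x - e) k))"
    proof (rule sum_mono)
      fix k
      show "1 - cmod (?z k) \<le> cmod (seq_of (cesaro_ces t x - e) k)"
        using norm_triangle_ineq2[of 1 "?z k"] seq_of_cesaro_ces[of t x] t e
        by (simp add: minus_ces.rep_eq norm_minus_commute)
    qed
    also have "\<dots> \<le> (real n + 1) * norm (cesaro_ces t x - e)"
      by (rule sum_le_norm)
    finally have "(real n + 1) * (1 / 2) \<le> (real n + 1) * norm (cesaro_ces t x - e)" .
    then have "1 / 2 \<le> norm (cesaro_ces t x - e)"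
      by (rule mult_left_le_imp_le) simp
    then show ?thesis by (simp add: dist_norm)
  qed
  have "e \<notin> closure (range (cesaro_ces t))"
    unfolding closure_approachable
  proof
    assume "\<forall>d>0. \<exists>y\<in>range (cesaro_ces t). dist y e < d"
    then obtain x where "dist (cesaro_ces t x) e < 1 / 2"
      by (metis half_gt_zero_iff imageE zero_less_one)
    then show False using dist[of x] by simp
  qed
  then show ?thesis by auto
qed

section \<open>Eigenvectors\<close>

text \<open>
  Via the recurrence this is \<open>(n + 1 - m) (n + 1 choose m) = (n + 1) (n choose m)\<close> for
  \<open>m \<le> n\<close>. Below index \<open>m\<close> the entries vanish, and the step to \<open>m\<close> imposes no condition on the
  entry there, because the coefficients of \<open>x m\<close> on the two sides agree exactly for the
  eigenvalue \<open>1 / (m + 1)\<close>.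
\<close>
lemma cesaro_binomial:
  "cesaro t (\<lambda>n. of_nat (n choose m) * of_real t ^ (n - m))
    = (\<lambda>n. 1 / (of_nat m + 1) * (of_nat (n choose m) * of_real t ^ (n - m)))"
  unfolding cesaro_eq_iff
proof (intro conjI allI)
  show "1 / (of_nat m + 1) * (of_nat (0 choose m) * of_real t ^ (0 - m))
      = (of_nat (0 choose m) * of_real t ^ (0 - m) :: complex)"
    by (cases m) simp_all
next
  fix n
  note nz = of_nat_plus_neq_0(1)[of m]
  show "(of_nat n + 2) * (1 / (of_nat m + 1) * (of_nat (Suc n choose m) * of_real t ^ (Suc n - m)))
    = (of_real t * (of_nat n + 1) * (1 / (of_nat m + 1) * (of_nat (n choose m) * of_real t ^ (n - m)))
      + of_nat (Suc n choose m) * of_real t ^ (Suc n - m) :: complex)"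
  proof (cases "m \<le> n")
    case True
    then obtain d where d: "n = m + d" using le_Suc_ex by blast
    have "Suc d * (Suc n choose m) = Suc n * (n choose m)"
      using binomial_absorb_comp[of "Suc n" m] by (simp add: d Suc_diff_le)
    then have b: "(of_nat d + 1) * of_nat (Suc n choose m) = (of_nat n + 1) * (of_nat (n choose m) :: complex)"
      by (metis of_nat_Suc of_nat_mult add.commute)
    have "(of_nat n + 2) * (of_nat (Suc n choose m) * of_real t ^ Suc d)
        - (of_nat m + 1) * (of_nat (Suc n choose m) * of_real t ^ Suc d)
      = of_real t ^ Suc d * ((of_nat d + 1) * of_nat (Suc n choose m) :: complex)"
      by (simp add: d algebra_simps)
    then show ?thesis
      using nz unfolding b by (simp add: d Suc_diff_le field_simps)
  next
    case False
    show ?thesis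
    proof (cases "m = Suc n")
      case True
      then show ?thesis using nz by (simp add: field_simps binomial_eq_0)
    next
      case False
      then show ?thesis using \<open>\<not> m \<le> n\<close> by (simp add: binomial_eq_0)
    qed
  qed
qed

lemma binomial_in_ces_infty:
  assumes t: "0 \<le> t" "t < 1"
  shows "(\<lambda>n. of_nat (n choose m) * complex_of_real t ^ (n - m)) \<in> ces_infty"
proof -
  \<comment> \<open>The ratio of consecutive entries. Where the truncated difference is \<open>0\<close>, so is \<open>A n\<close>,
    which fits: the entry at \<open>n\<close> vanishes there, and the entry \<open>1\<close> at \<open>m\<close> comes from the
    inhomogeneous term.\<close>
  define A where "A n = t * (real n + 1) / real (Suc n - m)" for n
  have "(\<lambda>n. t * (real n + 1) / (real n + 1 - real m)) \<longlonglongrightarrow> t"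
    by real_asymp
  moreover have "eventually (\<lambda>n. A n = t * (real n + 1) / (real n + 1 - real m)) sequentially"
    using eventually_ge_at_top[of m] by eventually_elim (simp add: A_def of_nat_diff Suc_diff_le)
  ultimately have "A \<longlonglongrightarrow> t"
    by (simp add: filterlim_cong)
  then obtain K where K: "K \<ge> 0"
    "\<And>u v n. (\<And>n. 0 \<le> u n) \<Longrightarrow> (\<And>n. 0 \<le> v n) \<Longrightarrow> u 0 \<le> v 0
        \<Longrightarrow> (\<And>n. u (Suc n) \<le> A n * u n + v (Suc n))
        \<Longrightarrow> sum u {..n} \<le> K * sum v {..n}"
    using summed_bound_of_recurrence t(2) by metis
  define u where "u n = real (n choose m) * t ^ (n - m)" for n
  have "sum u {..n} \<le> K * (\<Sum>k\<le>n. if k = m then 1 else 0)" for n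
  proof (rule K(2))
    fix k
    show "u (Suc k) \<le> A k * u k + (if Suc k = m then 1 else 0)"
    proof (cases "m \<le> k")
      case True
      then obtain d where d: "k = m + d" using le_Suc_ex by blast
      have "Suc d * (Suc k choose m) = Suc k * (k choose m)"
        using binomial_absorb_comp[of "Suc k" m] by (simp add: d Suc_diff_le)
      then have "(real d + 1) * real (Suc k choose m) = (real k + 1) * real (k choose m)"
        by (metis of_nat_Suc of_nat_mult add.commute)
      then show ?thesis
        by (simp add: u_def A_def d Suc_diff_le field_simps)
    next
      case False
      then show ?thesis
        by (cases "m = Suc k") (auto simp: u_def binomial_eq_0)
    qed
  qed (use t in \<open>auto simp: u_def\<close>)
  also have "K * (\<Sum>k\<le>n. if k = m then 1 else 0) \<le> K" for n
    using K(1) by (simp add: sum.delta)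
  finally have S: "sum u {..n} \<le> K" for n .
  show ?thesis
  proof (rule bounded_in_ces_infty)
    fix n
    have "cmod (of_nat (n choose m) * complex_of_real t ^ (n - m)) = u n"
      using t by (simp add: u_def norm_mult norm_power)
    also have "\<dots> \<le> sum u {..n}"
      using t by (intro member_le_sum) (auto simp: u_def)
    finally show "cmod (of_nat (n choose m) * complex_of_real t ^ (n - m)) \<le> K"
      using S order_trans by blast
  qed
qed

lemma ces_eigenvector:
  assumes t: "0 \<le> t" "t < 1" and \<mu>: "\<mu> \<in> Lambda"
  obtains x where "x \<noteq> 0" "cesaro_ces t x = \<mu> *\<^sub>C x"
proof -
  obtain m where m: "\<mu> = 1 / (of_nat m + 1)"
    using \<mu> by (auto simp: Lambda_def)
  define x where "x = Abs_ces (\<lambda>n. of_nat (n choose m) * of_real t ^ (n - m))"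
  have x: "seq_of x = (\<lambda>n. of_nat (n choose m) * of_real t ^ (n - m))"
    using binomial_in_ces_infty[OF t] by (simp add: x_def Abs_ces_inverse)
  have "seq_of x m \<noteq> seq_of 0 m"
    by (simp add: x zero_ces.rep_eq)
  then have "x \<noteq> 0" by auto
  moreover have "cesaro_ces t x = \<mu> *\<^sub>C x"
    using t by (intro ces_eqI)
      (simp add: seq_of_cesaro_ces scaleC_ces.rep_eq x cesaro_binomial m)
  ultimately show thesis by (rule that)
qed

section \<open>Invertibility off the eigenvalues\<close>

lemma shifted_cesaro_eq_iff:
  "(\<forall>n. cesaro t x n - \<mu> * x n = b n) \<longleftrightarrow> (1 - \<mu>) * x 0 = b 0 \<and>
    (\<forall>n. ((of_nat n + 2) * \<mu> - 1) * x (Suc n)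
      = of_real t * (of_nat n + 1) * (\<mu> * x n + b n) - (of_nat n + 2) * b (Suc n))"
proof -
  have "(\<forall>n. cesaro t x n - \<mu> * x n = b n) \<longleftrightarrow> cesaro t x = (\<lambda>n. \<mu> * x n + b n)"
    by (auto simp: fun_eq_iff algebra_simps)
  also have "\<dots> \<longleftrightarrow> (1 - \<mu>) * x 0 = b 0 \<and>
    (\<forall>n. ((of_nat n + 2) * \<mu> - 1) * x (Suc n)
      = of_real t * (of_nat n + 1) * (\<mu> * x n + b n) - (of_nat n + 2) * b (Suc n))"
    unfolding cesaro_eq_iff
    by (intro conj_cong iff_allI) (auto simp: algebra_simps)
  finally show ?thesis .
qed

lemma solvable_shifted_cesaro:
  assumes "\<mu> \<notin> Lambda"
  shows "\<exists>x. \<forall>n. cesaro t x n - \<mu> * x n = b n"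
proof -
  have nz: "(of_nat n + 1) * \<mu> - 1 \<noteq> 0" for n
  proof
    assume "(of_nat n + 1) * \<mu> - 1 = 0"
    then have "\<mu> = 1 / (of_nat n + 1)"
      using of_nat_plus_neq_0(1)[of n] by (simp add: field_simps)
    then show False using assms by (auto simp: Lambda_def)
  qed
  define x where "x = rec_nat (b 0 / (1 - \<mu>)) (\<lambda>n y. (of_real t * (of_nat n + 1) * (\<mu> * y + b n)
      - (of_nat n + 2) * b (Suc n)) / ((of_nat n + 2) * \<mu> - 1))"
  have "\<mu> \<noteq> 1" using nz[of 0] by auto
  moreover have "(of_nat n + 2) * \<mu> - 1 \<noteq> 0" for n
    using nz[of "Suc n"] by (simp add: algebra_simps)
  ultimately have "\<forall>n. cesaro t x n - \<mu> * x n = b n"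
    unfolding shifted_cesaro_eq_iff by (simp add: x_def)
  then show ?thesis by blast
qed

text \<open>
  Division of the recurrence by \<open>(k + 2) \<mu> - 1\<close> is multiplication by \<open>g (k + 1)\<close> after a
  factor \<open>k + 2\<close> has been cancelled. As \<open>g\<close> tends to \<open>1 / \<mu>\<close>, it is bounded, which controls the
  terms in \<open>b\<close>, and the modulus of the coefficient of \<open>x k\<close> is at most \<open>t \<bar>\<mu>\<bar> \<bar>g (k + 1)\<bar>\<close>, which tends to
  \<open>t\<close>. Here \<open>\<mu> \<noteq> 0\<close> is essential.
\<close>
lemma shifted_cesaro_bounded_below:
  assumes t: "0 \<le> t" "t < 1" and \<mu>: "\<mu> \<notin> Lambda \<union> {0}"
  obtains K where "K \<ge> 0"
    "\<And>x b n. (\<And>n. cesaro t x n - \<mu> * x n = b n)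
      \<Longrightarrow> (\<Sum>k\<le>n. cmod (x k)) \<le> K * (\<Sum>k\<le>n. cmod (b k))"
proof -
  have \<mu>0: "\<mu> \<noteq> 0" using \<mu> by simp
  define g where "g n = 1 / (\<mu> - 1 / (of_nat n + 1))" for n
  have nz: "\<mu> - 1 / (of_nat n + 1) \<noteq> 0" for n
    using \<mu> by (auto simp: Lambda_def)
  have "(\<lambda>n. 1 / (of_nat n + 1 :: complex)) \<longlonglongrightarrow> 0"
    using LIMSEQ_Suc[OF lim_1_over_n[where 'a=complex]] by (simp add: add.commute)
  then have g: "g \<longlonglongrightarrow> 1 / (\<mu> - 0)"
    unfolding g_def by (intro tendsto_intros) (use \<mu>0 in auto)
  have "Bseq g"
    using g by (blast intro: convergent_imp_Bseq convergentI)
  then obtain L where L: "L > 0" "\<And>n. cmod (g n) \<le> L"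
    by (auto simp: Bseq_def)
  define A where "A n = t * cmod \<mu> * cmod (g (Suc n))" for n
  have "A \<longlonglongrightarrow> t * cmod \<mu> * cmod (1 / (\<mu> - 0))"
    unfolding A_def by (intro tendsto_intros LIMSEQ_Suc g)
  then have "A \<longlonglongrightarrow> t"
    using \<mu>0 by (simp add: norm_divide)
  then obtain K where K: "K \<ge> 0"
    "\<And>u v n. (\<And>n. 0 \<le> u n) \<Longrightarrow> (\<And>n. 0 \<le> v n) \<Longrightarrow> u 0 \<le> v 0
        \<Longrightarrow> (\<And>n. u (Suc n) \<le> A n * u n + v (Suc n))
        \<Longrightarrow> sum u {..n} \<le> K * sum v {..n}"
    using summed_bound_of_recurrence t(2) by metis
  show thesis
  proof
    show "K * (2 * L) \<ge> 0" using K(1) L(1) by simp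
    fix x b :: "nat \<Rightarrow> complex" and n :: nat
    assume eq: "\<And>n. cesaro t x n - \<mu> * x n = b n"
    define v where "v k = L * (cmod (b k) + (if k = 0 then 0 else cmod (b (k - 1))))" for k
    have rec: "(1 - \<mu>) * x 0 = b 0"
      "((of_nat k + 2) * \<mu> - 1) * x (Suc k)
        = of_real t * (of_nat k + 1) * (\<mu> * x k + b k) - (of_nat k + 2) * b (Suc k)" for k
      using eq shifted_cesaro_eq_iff[of t x \<mu> b] by auto
    have "(\<Sum>k\<le>n. cmod (x k)) \<le> K * sum v {..n}"
    proof (rule K(2))
      fix k
      show "0 \<le> v k" using L(1) by (simp add: v_def)
      have "x 0 = - g 0 * b 0"
        using rec(1) nz[of 0] by (simp add: g_def field_simps)
      then have "cmod (x 0) = cmod (g 0) * cmod (b 0)"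
        by (simp add: norm_mult)
      also have "\<dots> \<le> L * cmod (b 0)"
        by (intro mult_right_mono L) simp
      finally show "cmod (x 0) \<le> v 0" by (simp add: v_def)
      define q where "q = (real k + 1) / (real k + 2)"
      have q: "0 \<le> q" "q \<le> 1" by (simp_all add: q_def)
      have tq: "0 \<le> t * q" "t * q \<le> t" "t * q \<le> 1"
        using q t mult_left_mono[OF q(2) t(1)] by auto
      note n2 = of_nat_plus_neq_0(2)[of k]
      have qc: "of_real q = (of_nat k + 1) / (of_nat k + 2 :: complex)"
        by (simp add: q_def)
      have gS: "g (Suc k) = 1 / (\<mu> - 1 / (of_nat k + 2))" "\<mu> - 1 / (of_nat k + 2) \<noteq> 0"
        using nz[of "Suc k"] by (simp_all add: g_def algebra_simps)
      have "(\<mu> - 1 / (of_nat k + 2)) * x (Suc k)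
          = ((of_nat k + 2) * \<mu> - 1) * x (Suc k) / (of_nat k + 2)"
        using n2 by (simp add: field_simps)
      also have "\<dots> = of_real (t * q) * (\<mu> * x k + b k) - b (Suc k)"
        unfolding rec(2) of_real_mult qc using n2 by (simp add: diff_divide_distrib)
      finally have "x (Suc k) = g (Suc k) * (of_real (t * q) * (\<mu> * x k + b k) - b (Suc k))"
        using gS(2) by (simp add: gS(1) eq_divide_eq mult.commute)
      then have "cmod (x (Suc k))
          = cmod (g (Suc k)) * cmod (of_real (t * q) * (\<mu> * x k + b k) - b (Suc k))"
        by (simp only: norm_mult)
      also have "\<dots> \<le> cmod (g (Suc k)) * (t * cmod \<mu> * cmod (x k) + (cmod (b k) + cmod (b (Suc k))))"
      proof (rule mult_left_mono)
        have "cmod (of_real (t * q) * (\<mu> * x k + b k) - b (Suc k))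
            \<le> cmod (of_real (t * q) * (\<mu> * x k + b k)) + cmod (b (Suc k))"
          by (rule norm_triangle_ineq4)
        also have "cmod (of_real (t * q) * (\<mu> * x k + b k)) = t * q * cmod (\<mu> * x k + b k)"
          using tq(1) by (simp only: norm_mult norm_of_real abs_of_nonneg)
        also have "\<dots> \<le> t * q * (cmod \<mu> * cmod (x k) + cmod (b k))"
          using tq(1) by (intro mult_left_mono) (metis norm_mult norm_triangle_ineq)
        also have "\<dots> \<le> t * (cmod \<mu> * cmod (x k)) + 1 * cmod (b k)"
          unfolding distrib_left using tq by (intro add_mono mult_right_mono) auto
        finally show "cmod (of_real (t * q) * (\<mu> * x k + b k) - b (Suc k))
            \<le> t * cmod \<mu> * cmod (x k) + (cmod (b k) + cmod (b (Suc k)))"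
          by (simp add: mult.assoc)
      qed simp
      also have "\<dots> = A k * cmod (x k) + cmod (g (Suc k)) * (cmod (b k) + cmod (b (Suc k)))"
        by (simp add: A_def algebra_simps)
      also have "\<dots> \<le> A k * cmod (x k) + L * (cmod (b k) + cmod (b (Suc k)))"
        using L by (intro add_left_mono mult_right_mono) auto
      finally show "cmod (x (Suc k)) \<le> A k * cmod (x k) + v (Suc k)"
        by (simp add: v_def add.commute)
    qed simp
    also have "sum v {..n} \<le> 2 * L * (\<Sum>k\<le>n. cmod (b k))"
    proof -
      have "(\<Sum>k\<le>n. if k = 0 then 0 else cmod (b (k - 1))) \<le> (\<Sum>k\<le>n. cmod (b k))"
      proof (cases n)
        case (Suc m)
        have "(\<Sum>k\<le>Suc m. if k = 0 then 0 else cmod (b (k - 1))) = (\<Sum>k\<le>m. cmod (b k))"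
          by (simp add: sum.atMost_Suc_shift del: sum.atMost_Suc)
        then show ?thesis by (simp add: Suc)
      qed simp
      then show ?thesis
        using L(1) mult_left_mono[of _ "\<Sum>k\<le>n. cmod (b k)" L]
        by (simp add: v_def sum_distrib_left[symmetric] sum.distrib distrib_left)
    qed
    finally show "(\<Sum>k\<le>n. cmod (x k)) \<le> K * (2 * L) * (\<Sum>k\<le>n. cmod (b k))"
      using K(1) by (simp add: mult_left_mono mult.assoc)
  qed
qed

text \<open>
  The lower bound serves three times: it places the formal solution in \<open>ces\<^sub>\<infinity>\<close>, it gives
  injectivity, and it bounds the inverse.
\<close>
lemma invertible_shifted_cesaro_ces:
  assumes t: "0 \<le> t" "t < 1" and \<mu>: "\<mu> \<notin> Lambda \<union> {0}"
  shows "invertible_op (shifted (cesaro_ces t) \<mu>)"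
proof -
  have t': "t \<le> 1" using t by simp
  let ?T = "shifted (cesaro_ces t) \<mu>"
  obtain K where K: "K \<ge> 0"
    "\<And>x b n. (\<And>n. cesaro t x n - \<mu> * x n = b n)
      \<Longrightarrow> (\<Sum>k\<le>n. cmod (x k)) \<le> K * (\<Sum>k\<le>n. cmod (b k))"
    using shifted_cesaro_bounded_below[OF t \<mu>] by metis
  have below: "norm x \<le> K * norm (?T x)" for x
  proof (rule norm_ces_leI)
    fix n
    have "(\<Sum>k\<le>n. cmod (seq_of x k)) \<le> K * (\<Sum>k\<le>n. cmod (seq_of (?T x) k))"
      using seq_of_shifted[OF t(1) t'] by (intro K(2)) simp
    also have "\<dots> \<le> K * ((real n + 1) * norm (?T x))"
      by (intro mult_left_mono sum_le_norm K)
    finally show "(\<Sum>k\<le>n. cmod (seq_of x k)) \<le> (real n + 1) * (K * norm (?T x))"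
      by (simp add: mult.left_commute)
  qed
  have "\<exists>x. ?T x = y" for y
  proof -
    obtain x where x: "\<And>n. cesaro t x n - \<mu> * x n = seq_of y n"
      using solvable_shifted_cesaro[of \<mu> t "seq_of y"] \<mu> by auto
    have "(\<Sum>k\<le>n. cmod (x k)) / (real n + 1) \<le> K * norm y" for n
    proof -
      have "(\<Sum>k\<le>n. cmod (x k)) \<le> K * ((real n + 1) * norm y)"
        using K(2)[OF x] mult_left_mono[OF sum_le_norm K(1)] order_trans by blast
      then show ?thesis by (simp add: divide_le_eq algebra_simps)
    qed
    then have "x \<in> ces_infty" unfolding ces_infty_iff by blast
    then have "?T (Abs_ces x) = y"
      using x by (intro ces_eqI) (simp add: seq_of_shifted[OF t(1) t'] Abs_ces_inverse)
    then show ?thesis ..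
  qed
  then obtain S where S: "\<And>y. ?T (S y) = y" by metis
  have inj: "x = y" if "?T x = ?T y" for x y
  proof -
    have "?T (x - y) = 0"
      using shifted_add[OF t(1) t', of \<mu> "x - y" y] that by simp
    then show ?thesis using below[of "x - y"] by simp
  qed
  have "S \<in> cont_lin_ops"
  proof (rule cont_lin_opsI)
    show "S (x + y) = S x + S y" for x y
      by (rule inj) (simp add: S shifted_add[OF t(1) t'])
    show "S (c *\<^sub>C x) = c *\<^sub>C S x" for c x
      by (rule inj) (simp add: S shifted_scaleC[OF t(1) t'])
    show "norm (S x) \<le> K * norm x" for x
      using below[of "S x"] by (simp add: S)
  qed
  moreover have "S \<circ> ?T = id" "?T \<circ> S = id"
    using S inj by (auto simp: fun_eq_iff)
  ultimately show ?thesis unfolding invertible_op_def by blast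
qed

section \<open>Operator norm and fine spectrum\<close>

lemma invertible_opD:
  assumes "invertible_op T"
  shows "inj T" "range T = UNIV"
proof -
  obtain S where "S \<circ> T = id" "T \<circ> S = id"
    using assms unfolding invertible_op_def by blast
  then have "bij T" by (simp add: o_bij)
  then show "inj T" "range T = UNIV" by (simp_all add: bij_def)
qed

lemma inj_cesaro_ces:
  assumes "0 \<le> t" "t \<le> 1"
  shows "inj (cesaro_ces t)"
proof (rule injI)
  fix x y assume "cesaro_ces t x = cesaro_ces t y"
  then have eq: "cesaro t (seq_of x) n = cesaro t (seq_of y) n" for n
    using seq_of_cesaro_ces[OF assms] by metis
  show "x = y"
  proof (rule ces_eqI)
    fix n
    show "seq_of x n = seq_of y n"
      using eq[of n] eq[of "n - 1"] cesaro_Suc[of "n - 1" t "seq_of x"]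
        cesaro_Suc[of "n - 1" t "seq_of y"] by (cases n) (auto simp: cesaro_0)
  qed
qed

lemma onorm_cesaro_ces:
  assumes t: "0 \<le> t" "t < 1"
  shows "onorm (cesaro_ces t) = 1"
proof (rule antisym)
  have t': "t \<le> 1" using t by simp
  show "onorm (cesaro_ces t) \<le> 1"
    using norm_cesaro_ces_le[OF t(1) t'] by (intro onorm_bound) auto
  have "1 \<in> Lambda"
    by (auto simp: Lambda_def intro!: exI[of _ 0])
  then obtain x where x: "x \<noteq> 0" "cesaro_ces t x = 1 *\<^sub>C x"
    using ces_eigenvector[OF t, of 1] by blast
  then show "1 \<le> onorm (cesaro_ces t)"
    using onorm[OF bounded_linear_cesaro_ces[OF t(1) t'], of x] by (simp add: scaleC_one)
qed

theorem theorem4p10: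
  fixes t :: real
  assumes "0 \<le> t" and "t < 1"
  shows "(\<forall>x\<in>ces_infty. cesaro t x \<in> ces_infty)
    \<and> cesaro_ces t \<in> cont_lin_ops
    \<and> onorm (cesaro_ces t) = 1
    \<and> compact_op (cesaro_ces t)
    \<and> spectrum (cesaro_ces t) = Lambda \<union> {0}
    \<and> point_spectrum (cesaro_ces t) = Lambda
    \<and> continuous_spectrum (cesaro_ces t) = {}
    \<and> residual_spectrum (cesaro_ces t) = {0}"
proof -
  have t': "t \<le> 1" using assms by simp
  let ?T = "\<lambda>\<mu>. shifted (cesaro_ces t) \<mu>"
  have zero: "?T 0 = cesaro_ces t"
    by (intro ext ces_eqI) (simp add: seq_of_shifted[OF assms(1) t'] seq_of_cesaro_ces[OF assms(1) t'])
  have "0 \<notin> Lambda"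
    using of_nat_plus_neq_0(1) by (simp add: Lambda_def)
  have zero_inj: "inj (?T 0)" and zero_range: "closure (range (?T 0)) \<noteq> UNIV"
    unfolding zero using inj_cesaro_ces[OF assms(1) t'] range_cesaro_ces_not_dense[OF assms] by auto
  have eigen: "\<not> inj (?T \<mu>)" if \<mu>: "\<mu> \<in> Lambda" for \<mu>
  proof -
    obtain x where "x \<noteq> 0" "cesaro_ces t x = \<mu> *\<^sub>C x"
      by (rule ces_eigenvector[OF assms \<mu>])
    moreover have "?T \<mu> 0 = 0"
      using shifted_add[OF assms(1) t', of \<mu> 0 0] by simp
    ultimately have "?T \<mu> x = ?T \<mu> 0" "x \<noteq> 0"
      by (simp_all add: shifted_def)
    then show ?thesis by (auto dest: injD)
  qed
  have regular: "invertible_op (?T \<mu>)" if "\<mu> \<notin> Lambda" "\<mu> \<noteq> 0" for \<mu>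
    using invertible_shifted_cesaro_ces[OF assms] that by simp
  have inj_iff: "inj (?T \<mu>) \<longleftrightarrow> \<mu> \<notin> Lambda" for \<mu>
    using eigen zero_inj regular invertible_opD(1) by (cases "\<mu> = 0") auto
  have surj_iff: "range (?T \<mu>) = UNIV \<longleftrightarrow> \<mu> \<noteq> 0" if "\<mu> \<notin> Lambda" for \<mu>
  proof (cases "\<mu> = 0")
    case True
    then show ?thesis using zero_range by auto
  next
    case False
    then show ?thesis using regular[OF that] invertible_opD(2) by simp
  qed
  have dense_iff: "closure (range (?T \<mu>)) = UNIV \<longleftrightarrow> \<mu> \<noteq> 0" if "\<mu> \<notin> Lambda" for \<mu>
  proof (cases "\<mu> = 0")
    case True
    then show ?thesis using zero_range by simp
  next
    case False
    then have "range (?T \<mu>) = UNIV" using surj_iff[OF that] by simp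
    then show ?thesis using False by simp
  qed
  have "invertible_op (?T \<mu>) \<longleftrightarrow> \<mu> \<notin> Lambda \<union> {0}" for \<mu>
    using regular[of \<mu>] invertible_opD[of "?T \<mu>"] inj_iff[of \<mu>] surj_iff[of \<mu>] by auto
  then have "spectrum (cesaro_ces t) = Lambda \<union> {0}"
    unfolding spectrum_def by auto
  moreover have "point_spectrum (cesaro_ces t) = Lambda"
    unfolding point_spectrum_def inj_iff by simp
  moreover have "continuous_spectrum (cesaro_ces t) = {}"
    unfolding continuous_spectrum_def inj_iff using surj_iff dense_iff by blast
  moreover have "residual_spectrum (cesaro_ces t) = {0}"
    unfolding residual_spectrum_def inj_iff using dense_iff \<open>0 \<notin> Lambda\<close> by blast
  ultimately show ?thesis
    using cesaro_in_ces_infty[OF assms(1) t'] cesaro_ces_in_cont_lin_ops[OF assms(1) t']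
      onorm_cesaro_ces[OF assms] compact_op_cesaro_ces[OF assms] by blast
qed

end
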